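(* Let $n\ge 2$ be an integer, $a>0$ and $0<\alpha<1$. Let $X_1,\dots,X_n$ be independent random variables with a common distribution on $(-a,a)$, let $\mathbf{R}=(R_1,\dots,R_n)$ be a random vector with the Dirichlet distribution $D_n(1,\dots,1)$ that is independent of $(X_1,\dots,X_n)$, and let $S_n=\sum_{i=1}^n R_iX_i$. Then $S_n$ has the $\mathrm{Beta}(n\alpha,\,n(1-\alpha),\,-a,\,2a)$ distribution on $(-a,a)$ if and only if $X_1,\dots,X_n$ have the generalized $\mathrm{Arcsin}(\alpha)$ distribution on $(-a,a)$.
   Context: The Dirichlet distribution $D_n(1,\dots,1)$ is the uniform distribution on the simplex $\{(r_1,\dots,r_n): r_i\ge 0,\ \sum_{i=1}^n r_i=1\}$. Equivalently, it is the distribution of the vector of spacings $R_i=U_{(i)}-U_{(i-1)}$, $i=1,\dots,n$, where $U_{(1)}\le\dots\le U_{(n-1)}$ are the order statistics of $n-1$ independent uniform random variables on $[0,1]$, with $U_{(0)}=0$ and $U_{(n)}=1$. For $p,q>0$, $c\in\mathbb{R}$ and $h>0$, $\mathrm{Beta}(p,q,c,h)$ denotes the Beta distribution with location $c$ and scale $h$, i.e. the distribution of $c+hB$ where $B$ has the standard Beta distribution on $(0,1)$ with density $\frac{\Gamma(p+q)}{\Gamma(p)\Gamma(q)}x^{p-1}(1-x)^{q-1}$, $0<x<1$. The generalized $\mathrm{Arcsin}(\alpha)$ distribution on $(-a,a)$, $0<\alpha<1$, is $\mathrm{Beta}(\alpha,1-\alpha,-a,2a)$, i.e. the distribution of $-a+2aB$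 where $B$ has density $\frac{1}{\Gamma(\alpha)\Gamma(1-\alpha)}x^{\alpha-1}(1-x)^{-\alpha}$, $0<x<1$. (For $\alpha=\tfrac12$ this is the usual Arcsin distribution on $(-a,a)$.) *)

theory Defs
  imports "HOL-Probability.Probability"
begin

definition beta_density :: "real \<Rightarrow> real \<Rightarrow> real \<Rightarrow> real" where
  "beta_density p q x =
     (if 0 < x \<and> x < 1
      then Gamma (p + q) / (Gamma p * Gamma q) * x powr (p - 1) * (1 - x) powr (q - 1)
      else 0)"

text \<open>The law of \<open>c + h * B\<close> with \<open>B\<close> standard Beta distributed; meaningful for
  \<open>p, q, h > 0\<close>.\<close>

definition beta_distr :: "real \<Rightarrow> real \<Rightarrow> real \<Rightarrow> real \<Rightarrow> real measure" where
  "beta_distr p q c h =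
     distr (density lborel (\<lambda>x. ennreal (beta_density p q x))) borel (\<lambda>x. c + h * x)"

definition arcsin_distr :: "real \<Rightarrow> real \<Rightarrow> real measure" where
  "arcsin_distr \<alpha> a = beta_distr \<alpha> (1 - \<alpha>) (- a) (2 * a)"

definition prob_simplex :: "nat \<Rightarrow> (nat \<Rightarrow> real) set" where
  "prob_simplex n =
     {r \<in> {1..n} \<rightarrow>\<^sub>E UNIV. (\<forall>i\<in>{1..n}. 0 \<le> r i) \<and> (\<Sum>i\<in>{1..n}. r i) = 1}"

definition simplex_chart :: "nat \<Rightarrow> (nat \<Rightarrow> real) \<Rightarrow> nat \<Rightarrow> real" where
  "simplex_chart n r = (\<lambda>i\<in>{1..n}. if i < n then r i else 1 - (\<Sum>j\<in>{1..<n}. r j))"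

text \<open>The simplex is a null set of \<open>n\<close>-dimensional space, so its uniform distribution is taken,
  as usual for Dirichlet distributions, with respect to Lebesgue measure in the first \<open>n - 1\<close>
  coordinates, the last one being determined by the others. As \<open>simplex_chart n\<close> is affine, it
  scales \<open>(n - 1)\<close>-dimensional volume by a constant factor, which the normalization cancels.
  Intended for \<open>n \<ge> 1\<close>.\<close>

definition dirichlet_ones :: "nat \<Rightarrow> (nat \<Rightarrow> real) measure" where
  "dirichlet_ones n =
     distr
       (uniform_measure (\<Pi>\<^sub>M i\<in>{1..<n}. lborel)
          {r \<in> {1..<n} \<rightarrow>\<^sub>E UNIV. simplex_chart n r \<in> prob_simplex n})
       (\<Pi>\<^sub>M i\<in>{1..n}. borel)
       (simplex_chart n)"

end

theory Submission
  imports Defs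
begin

text \<open>
After the affine change of variables \<open>x \<mapsto> (x + a) / (2 a)\<close>, which commutes with averaging since
the weights sum to one, all variables take values in \<open>[0, 1]\<close>. Write \<open>Y\<^sub>i\<close> for the rescaled
\<open>X\<^sub>i\<close> and \<open>T = \<Sum>i. R\<^sub>i Y\<^sub>i\<close>. The proof compares moments.

Integration over the simplex shows, for fixed points \<open>y\<^sub>i\<close>, that the \<open>k\<close>-th moment of
\<open>\<Sum>i. R\<^sub>i y\<^sub>i\<close> is \<open>k! (n - 1)! / (n - 1 + k)!\<close> times the coefficient of \<open>t\<^sup>k\<close> in
\<open>\<Prod>i. 1 / (1 - y\<^sub>i t)\<close> (\<open>nn_integral_dirichlet_ones_power\<close>). Taking expectations over the
independent \<open>Y\<^sub>i\<close> replaces this product by \<open>F\<^sup>n\<close>, where \<open>F = \<Sum>k. E Y\<^sup>k t\<^sup>k\<close> is the common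
moment series (\<open>expectation_average_power\<close>). This is the series form of
\<open>E (1 - t T)\<^sup>-\<^sup>n = (E (1 - t Y)\<^sup>-\<^sup>1)\<^sup>n\<close>.

So the law of \<open>T\<close> and \<open>F\<^sup>n\<close> determine each other, moments being enough for laws with
bounded support (\<open>real_distribution_eqI_moments\<close>), and likewise the law of \<open>Y\<close> and \<open>F\<close>.
Since \<open>F\<close> has constant term \<open>1\<close>, it is determined by \<open>F\<^sup>n\<close>
(\<open>fps_power_eq_imp_eq\<close>). Both directions of the theorem therefore reduce to one computation:
\<open>Y\<close> has law \<open>Beta(\<alpha>, 1 - \<alpha>)\<close> exactly if \<open>F\<close> is the binomial series of exponent
\<open>- \<alpha>\<close>, its \<open>n\<close>-th power is the binomial series of exponent \<open>- n \<alpha>\<close>, and this series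
encodes the moments of \<open>Beta(n \<alpha>, n (1 - \<alpha>))\<close> (\<open>average_std_beta_iff\<close>).
\<close>

section \<open>Power integrals over a simplex\<close>

lemma has_real_derivative_power_div_fact:
  "((\<lambda>y. y ^ Suc j / fact (Suc j)) has_real_derivative y ^ j / fact j) (at y within A)"
  by (rule DERIV_cdivide[OF DERIV_power[OF DERIV_ident], THEN DERIV_cong])
     (simp add: divide_simps)

text \<open>The base case and the inductive step are each one application of the fundamental theorem of
calculus; the step is an integration by parts whose boundary terms vanish and which turns
\<open>(j + 1, p)\<close> into \<open>(j, p + 1)\<close>. Dividing the powers by factorials makes the family
closed under convolution without any Beta function constant.\<close>
lemma simplex_convolution_has_integral:
  fixes s :: real
  assumes "0 \<le> s"
  shows "((\<lambda>y. y ^ j / fact j * ((s - y) ^ p / fact p)) has_integral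
           s ^ (j + p + 1) / fact (j + p + 1)) {0..s}"
proof (induction j arbitrary: p)
  have deriv: "((\<lambda>y. - ((s - y) ^ Suc p / fact (Suc p))) has_real_derivative (s - y) ^ p / fact p)
      (at y within {0..s})" for p y
  proof -
    have "((\<lambda>y. s - y) has_real_derivative - 1) (at y within {0..s})"
      by (auto intro!: derivative_eq_intros)
    from DERIV_minus[OF DERIV_chain2[OF has_real_derivative_power_div_fact this]]
    show ?thesis by simp
  qed
  {
    case 0
    have "((\<lambda>y. (s - y) ^ p / fact p) has_integral
            - ((s - s) ^ Suc p / fact (Suc p)) - - ((s - 0) ^ Suc p / fact (Suc p))) {0..s}"
      using deriv
      by (intro fundamental_theorem_of_calculus assms)
         (simp only: has_real_derivative_iff_has_vector_derivative)
    then show ?case by simp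
  next
    case (Suc j)
    let ?G = "\<lambda>y. y ^ Suc j / fact (Suc j) * - ((s - y) ^ Suc p / fact (Suc p))"
    have "((\<lambda>y. y ^ j / fact j * - ((s - y) ^ Suc p / fact (Suc p))
              + (s - y) ^ p / fact p * (y ^ Suc j / fact (Suc j))) has_integral ?G s - ?G 0) {0..s}"
      using DERIV_mult[OF has_real_derivative_power_div_fact deriv]
      by (intro fundamental_theorem_of_calculus assms)
         (simp only: has_real_derivative_iff_has_vector_derivative)
    from has_integral_add[OF this Suc.IH[of "Suc p"]] show ?case
      by (simp add: mult.commute)
  }
qed

lemma fps_nth_prod_nonneg:
  fixes f :: "'a \<Rightarrow> real fps"
  assumes "\<And>i k. i \<in> I \<Longrightarrow> 0 \<le> fps_nth (f i) k"
  shows "0 \<le> fps_nth (\<Prod>i\<in>I. f i) k"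
  using assms
  by (induction I arbitrary: k rule: infinite_finite_induct)
     (auto simp: fps_mult_nth fps_one_nth intro!: sum_nonneg)

text \<open>The power series \<open>1 / (1 - c t)\<close>. The \<open>k\<close>-th coefficient of a product of such series is
the complete homogeneous symmetric polynomial of degree \<open>k\<close> in the parameters.\<close>
definition geometric_fps :: "real \<Rightarrow> real fps" where
  "geometric_fps c = Abs_fps (\<lambda>k. c ^ k)"

lemma fps_nth_geometric [simp]: "fps_nth (geometric_fps c) k = c ^ k"
  by (simp add: geometric_fps_def)

text \<open>Membership only constrains the values on \<open>I\<close>, so that updating a function at a new index
relates the simplices over \<open>I\<close> and over \<open>insert i I\<close> directly.\<close>
definition solid_simplex :: "'a set \<Rightarrow> real \<Rightarrow> ('a \<Rightarrow> real) set" where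
  "solid_simplex I s = {r. (\<forall>i\<in>I. 0 \<le> r i) \<and> (\<Sum>i\<in>I. r i) \<le> s}"

lemma measurable_indicator_solid_simplex [measurable]:
  assumes "finite I"
  shows "(\<lambda>r. indicator (solid_simplex I s) r :: ennreal) \<in> borel_measurable (\<Pi>\<^sub>M i\<in>I. lborel)"
proof -
  have [measurable]: "Measurable.pred (\<Pi>\<^sub>M i\<in>I. lborel) (\<lambda>r. (\<forall>i\<in>I. 0 \<le> r i) \<and> (\<Sum>i\<in>I. r i) \<le> s)"
    using assms by (intro pred_intros_logic pred_intros_finite) measurable
  show ?thesis unfolding solid_simplex_def by measurable
qed

lemma power_add_div_fact:
  fixes u v :: real
  shows "(u + v) ^ k / fact k = (\<Sum>j\<le>k. u ^ j / fact j * (v ^ (k - j) / fact (k - j)))"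
  by (simp add: binomial_ring sum_divide_distrib binomial_fact field_simps)

text \<open>The weight \<open>s - (\<Sum>i\<in>I. r i)\<close> left over by the coordinates is given to an extra point
\<open>x0\<close>. The size \<open>s\<close> stays variable because fixing one coordinate \<open>y\<close> leaves a simplex of
size \<open>s - y\<close>. The binomial theorem separates this coordinate, the inner integral is known by
induction, and the outer one is the convolution integral above; what remains is the Cauchy
product with the geometric series of the new point.\<close>
lemma nn_integral_solid_simplex_power:
  fixes x :: "'a \<Rightarrow> real"
  assumes "finite I" and "\<And>i. i \<in> I \<Longrightarrow> 0 \<le> x i" and x0: "0 \<le> x0" and "0 \<le> s"
  shows "(\<integral>\<^sup>+ r. ennreal (((s - (\<Sum>i\<in>I. r i)) * x0 + (\<Sum>i\<in>I. r i * x i)) ^ k / fact k) *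
              indicator (solid_simplex I s) r \<partial>(\<Pi>\<^sub>M i\<in>I. lborel)) =
         ennreal (s ^ (card I + k) / fact (card I + k) *
              fps_nth (geometric_fps x0 * (\<Prod>i\<in>I. geometric_fps (x i))) k)"
  using assms(1,2,4)
proof (induction I arbitrary: s k rule: finite_induct)
  case empty
  interpret product_sigma_finite "\<lambda>_. lborel :: real measure" ..
  show ?case using empty by
      (simp add: PiM_empty solid_simplex_def power_mult_distrib nn_integral_count_space_finite)
next
  case (insert i I)
  interpret product_sigma_finite "\<lambda>_. lborel :: real measure" ..
  define c where "c = (\<lambda>k. fps_nth (geometric_fps x0 * (\<Prod>i\<in>I. geometric_fps (x i))) k)"
  have c_nonneg: "0 \<le> c k" for k
    unfolding c_def fps_mult_nth using insert.prems x0
    by (intro sum_nonneg mult_nonneg_nonneg fps_nth_prod_nonneg) auto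
  let ?L = "\<lambda>r s. (s - (\<Sum>i\<in>I. r i)) * x0 + (\<Sum>i\<in>I. r i * x i)"
  let ?m = "card I"
  have fin: "finite (insert i I)" using insert.hyps by simp
  note [measurable] = measurable_indicator_solid_simplex[OF fin]
      measurable_indicator_solid_simplex[OF insert.hyps(1)]
  \<comment> \<open>Integral over the remaining coordinates once the new one is fixed at \<open>y\<close>; both sides
    vanish unless \<open>0 \<le> y \<le> s\<close>.\<close>
  have inner: "(\<integral>\<^sup>+ r. ennreal (((s - (\<Sum>l\<in>insert i I. (r(i := y)) l)) *
      x0 + (\<Sum>l\<in>insert i I. (r(i := y)) l * x l)) ^ k / fact k) *
              indicator (solid_simplex (insert i I) s) (r(i := y)) \<partial>(\<Pi>\<^sub>M i\<in>I. lborel))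
      = (\<Sum>j\<le>k. ennreal (x i ^ j * c (k - j)) *
           ennreal (y ^ j / fact j * ((s - y) ^ (?m + (k - j)) / fact (?m + (k - j))) *
               indicator {0..s} y))"
    (is "?A = ?B") for y
  proof (cases "0 \<le> y \<and> y \<le> s")
    case True
    have nn: "0 \<le> ?L r (s - y)" if "r \<in> solid_simplex I (s - y)" for r
      using that insert.prems x0
      by (auto simp: solid_simplex_def intro!: add_nonneg_nonneg mult_nonneg_nonneg sum_nonneg)
    have ind: "r(i := y) \<in> solid_simplex (insert i I) s \<longleftrightarrow> r \<in> solid_simplex I (s - y)" for r
    proof -
      have "(\<Sum>l\<in>I. (r(i := y)) l) = (\<Sum>l\<in>I. r l)"
        using insert.hyps by (intro sum.cong) auto
      then show ?thesis
        using insert.hyps True by (auto simp: solid_simplex_def)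
    qed
    have L: "(s - (\<Sum>l\<in>insert i I. (r(i := y)) l)) * x0 + (\<Sum>l\<in>insert i I. (r(i := y)) l * x l)
        = y * x i + ?L r (s - y)" for r
    proof -
      have "(\<Sum>l\<in>I. (r(i := y)) l) = (\<Sum>l\<in>I. r l)" "(\<Sum>l\<in>I. (r(i := y)) l * x l) = (\<Sum>l\<in>I. r l * x l)"
        using insert.hyps by (auto intro!: sum.cong)
      then show ?thesis
        using insert.hyps by (simp add: algebra_simps)
    qed
    have "?A = (\<integral>\<^sup>+ r. (\<Sum>j\<le>k. ennreal ((y * x i) ^ j / fact j) *
                 (ennreal (?L r (s - y) ^ (k - j) / fact (k - j)) *
                     indicator (solid_simplex I (s - y)) r)) \<partial>(\<Pi>\<^sub>M i\<in>I. lborel))"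
      unfolding L
    proof (intro nn_integral_cong)
      fix r :: "'a \<Rightarrow> real"
      show "ennreal ((y * x i + ?L r (s - y)) ^ k / fact k) *
          indicator (solid_simplex (insert i I) s) (r(i := y)) =
        (\<Sum>j\<le>k. ennreal ((y * x i) ^ j / fact j) *
                 (ennreal (?L r (s - y) ^ (k - j) / fact (k - j)) *
                     indicator (solid_simplex I (s - y)) r))"
      proof (cases "r \<in> solid_simplex I (s - y)")
        case r: True
        have "ennreal ((y * x i + z) ^ k / fact k) =
            (\<Sum>j\<le>k. ennreal ((y * x i) ^ j / fact j) * ennreal (z ^ (k - j) / fact (k - j)))"
          if "0 \<le> z" for z
          unfolding power_add_div_fact using that True insert.prems
          by (subst sum_ennreal[symmetric]) (auto intro!: sum.cong
              simp del: times_divide_eq_left times_divide_eq_right times_divide_times_eq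
              simp: ennreal_mult[symmetric])
        from this[OF nn[OF r]] show ?thesis
          using r by (simp only: ind indicator_simps mult_1_right)
      qed (simp add: ind)
    qed
    also have "\<dots> = (\<Sum>j\<le>k. ennreal ((y * x i) ^ j / fact j) *
         ennreal ((s - y) ^ (?m + (k - j)) / fact (?m + (k - j)) * c (k - j)))"
      using insert.IH[of "s - y"] insert.prems True unfolding c_def
      by (subst nn_integral_sum; simp add: nn_integral_cmult)
    also have "\<dots> = ?B"
      using True insert.prems c_nonneg
      by (intro sum.cong refl) (simp add: ennreal_mult[symmetric] power_mult_distrib mult_ac)
    finally show ?thesis .
  next
    case False
    have "r(i := y) \<notin> solid_simplex (insert i I) s" if "r \<in> space (\<Pi>\<^sub>M i\<in>I. lborel)"
        for r :: "'a \<Rightarrow> real"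
    proof
      assume *: "r(i := y) \<in> solid_simplex (insert i I) s"
      have "(\<Sum>l\<in>I. (r(i := y)) l) \<ge> 0"
        using * by (intro sum_nonneg) (auto simp: solid_simplex_def)
      then show False using * False insert.hyps by (auto simp: solid_simplex_def)
    qed
    then have "?A = (\<integral>\<^sup>+ r. 0 \<partial>(\<Pi>\<^sub>M i\<in>I. (lborel :: real measure)))"
      by (intro nn_integral_cong) (simp del: fun_upd_apply)
    then show ?thesis using False by simp
  qed
  \<comment> \<open>The new coordinate contributes a convolution of two normalized powers.\<close>
  have outer: "(\<integral>\<^sup>+ y. ennreal (y ^ j / fact j * ((s - y) ^ p / fact p) * indicator {0..s} y) \<partial>lborel)
       = ennreal (s ^ (j + p + 1) / fact (j + p + 1))" for j p
  proof (rule nn_integral_has_integral_lborel)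
    show "((\<lambda>y. y ^ j / fact j * ((s - y) ^ p / fact p) * indicator {0..s} y) has_integral
        s ^ (j + p + 1) / fact (j + p + 1)) UNIV"
      using simplex_convolution_has_integral[OF insert.prems(2), of j p]
      unfolding has_integral_restrict_UNIV[symmetric, where s = "{0..s}"]
      by (rule has_integral_eq[rotated]) (auto simp: indicator_def)
  qed (auto simp: indicator_def)
  have "(\<integral>\<^sup>+ r. ennreal (((s - (\<Sum>l\<in>insert i I. r l)) * x0 + (\<Sum>l\<in>insert i I. r l * x l)) ^ k / fact k) *
              indicator (solid_simplex (insert i I) s) r \<partial>(\<Pi>\<^sub>M i\<in>insert i I. lborel)) =
     (\<integral>\<^sup>+ y. (\<Sum>j\<le>k. ennreal (x i ^ j * c (k - j)) *
           ennreal (y ^ j / fact j * ((s - y) ^ (?m + (k - j)) / fact (?m + (k - j))) *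
               indicator {0..s} y)) \<partial>lborel)"
    using insert.hyps by (subst product_nn_integral_insert_rev) (simp_all only: inner, measurable)
  also have "\<dots> = (\<Sum>j\<le>k. ennreal (x i ^ j * c (k - j)) *
      ennreal (s ^ (j + (?m + (k - j)) + 1) / fact (j + (?m + (k - j)) + 1)))"
    by (subst nn_integral_sum, measurable, intro sum.cong refl, subst nn_integral_cmult)
       (measurable, simp only: outer)
  also have "\<dots> = (\<Sum>j\<le>k. ennreal (x i ^ j * c (k - j) * (s ^ (?m + 1 + k) / fact (?m + 1 + k))))"
    using insert.prems c_nonneg
    by (intro sum.cong refl) (simp add: ennreal_mult[symmetric])
  also have "\<dots> = ennreal (s ^ (?m + 1 + k) / fact (?m + 1 + k) * (\<Sum>j\<le>k. x i ^ j * c (k - j)))"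
    using insert.prems c_nonneg
    by (subst sum_ennreal) (auto simp: sum_distrib_left sum_divide_distrib mult_ac)
  also have "(\<Sum>j\<le>k. x i ^ j * c (k - j)) = fps_nth (geometric_fps (x i) * (geometric_fps x0 *
      (\<Prod>i\<in>I. geometric_fps (x i)))) k"
    unfolding c_def by (simp add: fps_mult_nth[of "geometric_fps (x i)"] atMost_atLeast0)
  also have "geometric_fps (x i) * (geometric_fps x0 * (\<Prod>i\<in>I. geometric_fps (x i))) =
      geometric_fps x0 * (\<Prod>i\<in>insert i I. geometric_fps (x i))"
    using insert.hyps by (simp add: mult_ac)
  finally show ?case using insert.hyps by simp
qed

section \<open>Moments of Dirichlet averages of fixed points\<close>

lemma fps_nth_0_prod: "fps_nth (\<Prod>i\<in>I. f i) 0 = (\<Prod>i\<in>I. fps_nth (f i) 0)"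
  for f :: "'a \<Rightarrow> real fps"
  by (induction I rule: infinite_finite_induct) auto

lemma sets_PiM_lborel: "sets (\<Pi>\<^sub>M i\<in>I. lborel :: real measure) = sets (\<Pi>\<^sub>M i\<in>I. borel)"
  by (rule sets_PiM_cong) auto

lemma simplex_chart_eq:
  assumes "1 \<le> n"
  shows "simplex_chart n r = (\<lambda>i\<in>insert n {1..<n}. if i < n then r i else 1 - (\<Sum>j\<in>{1..<n}. r j))"
proof -
  have "{1..n} = insert n {1..<n}" using assms by auto
  then show ?thesis by (simp only: simplex_chart_def)
qed

lemma measurable_simplex_chart [measurable]:
  "simplex_chart n \<in> measurable (\<Pi>\<^sub>M i\<in>{1..<n}. borel) (\<Pi>\<^sub>M i\<in>{1..n}. borel)"
  unfolding simplex_chart_def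
proof (rule measurable_restrict)
  fix i assume i: "i \<in> {1..n}"
  show "(\<lambda>r. if i < n then r i else 1 - (\<Sum>j\<in>{1..<n}. r j) :: real)
      \<in> borel_measurable (\<Pi>\<^sub>M i\<in>{1..<n}. borel)"
  proof (cases "i < n")
    case True
    with i show ?thesis by simp
  next
    case False
    have "(\<lambda>r. 1 - (\<Sum>j\<in>{1..<n}. r j)) \<in> borel_measurable (\<Pi>\<^sub>M i\<in>{1..<n}. (borel :: real measure))"
      by (intro borel_measurable_diff borel_measurable_const borel_measurable_sum
            measurable_component_singleton)
    with False show ?thesis by (simp only: if_False)
  qed
qed

lemma prob_simplex_sets [measurable]: "prob_simplex n \<in> sets (\<Pi>\<^sub>M i\<in>{1..n}. borel)"
proof -
  have "{r \<in> space (\<Pi>\<^sub>M i\<in>{1..n}. borel). (\<forall>i\<in>{1..n}. 0 \<le> r i) \<and> (\<Sum>i\<in>{1..n}. r i) = 1}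
          \<in> sets (\<Pi>\<^sub>M i\<in>{1..n}. (borel :: real measure))"
    by measurable
  also have "{r \<in> space (\<Pi>\<^sub>M i\<in>{1..n}. borel). (\<forall>i\<in>{1..n}. 0 \<le> r i) \<and> (\<Sum>i\<in>{1..n}. r i) = 1}
      = prob_simplex n"
    by (simp add: prob_simplex_def space_PiM)
  finally show ?thesis .
qed

lemma sum_simplex_chart:
  assumes "1 \<le> n"
  shows "(\<Sum>i\<in>{1..n}. f (simplex_chart n r i) i) =
           (f (1 - (\<Sum>j\<in>{1..<n}. r j)) n + (\<Sum>i\<in>{1..<n}. f (r i) i) :: real)"
proof -
  have *: "{1..n} = insert n {1..<n}" using assms by auto
  show ?thesis unfolding * simplex_chart_eq[OF assms]
    by (subst sum.insert) (auto intro!: sum.cong)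
qed

lemma simplex_chart_in_prob_simplex_iff:
  assumes "1 \<le> n"
  shows "simplex_chart n r \<in> prob_simplex n \<longleftrightarrow> r \<in> solid_simplex {1..<n} 1"
proof -
  have *: "{1..n} = insert n {1..<n}" using assms by auto
  have "(\<Sum>i\<in>{1..n}. simplex_chart n r i) = 1"
    using sum_simplex_chart[OF assms, of "\<lambda>x i. x" r] by simp
  moreover have "simplex_chart n r \<in> {1..n} \<rightarrow>\<^sub>E UNIV"
    by (simp add: simplex_chart_def)
  ultimately show ?thesis
    unfolding prob_simplex_def solid_simplex_def * simplex_chart_eq[OF assms] by auto
qed

lemma simplex_chart_domain_sets:
  "{r \<in> {1..<n} \<rightarrow>\<^sub>E UNIV. simplex_chart n r \<in> prob_simplex n} \<in> sets (\<Pi>\<^sub>M i\<in>{1..<n}. borel)"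
proof -
  have "simplex_chart n -` prob_simplex n \<inter> space (\<Pi>\<^sub>M i\<in>{1..<n}. borel) \<in> sets (\<Pi>\<^sub>M i\<in>{1..<n}. borel)"
    by measurable
  then show ?thesis by (simp add: space_PiM vimage_def Int_def conj_commute)
qed

lemma AE_dirichlet_ones: "AE r in dirichlet_ones n. r \<in> prob_simplex n"
  unfolding dirichlet_ones_def
  using simplex_chart_domain_sets[of n]
  by (subst AE_distr_iff)
     (auto simp del: One_nat_def simp: sets_PiM_lborel
           cong: measurable_cong_sets intro!: AE_uniform_measureI)

lemma sets_dirichlet_ones: "sets (dirichlet_ones n) = sets (\<Pi>\<^sub>M i\<in>{1..n}. borel)"
  by (simp add: dirichlet_ones_def)

text \<open>Under the chart, the last coordinate plays the role of the left-over weight in the integral over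
the solid simplex. The case \<open>k = 0\<close> of that integral is the volume \<open>1 / (n - 1)!\<close> by which
the uniform measure is normalized.\<close>
lemma nn_integral_dirichlet_ones_power:
  fixes x :: "nat \<Rightarrow> real"
  assumes n: "1 \<le> n" and x: "\<And>i. i \<in> {1..n} \<Longrightarrow> 0 \<le> x i"
  shows "(\<integral>\<^sup>+ r. ennreal ((\<Sum>i\<in>{1..n}. r i * x i) ^ k) \<partial>dirichlet_ones n) =
         ennreal (fact k * fact (n - 1) / fact (n - 1 + k) *
                  fps_nth (\<Prod>i\<in>{1..n}. geometric_fps (x i)) k)"
proof -
  let ?P = "\<Pi>\<^sub>M i\<in>{1..<n}. lborel :: real measure"
  let ?D = "{r \<in> {1..<n} \<rightarrow>\<^sub>E UNIV. simplex_chart n r \<in> prob_simplex n}"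
  let ?h = "\<lambda>k. fps_nth (\<Prod>i\<in>{1..n}. geometric_fps (x i)) k"
  have chart: "simplex_chart n \<in> measurable ?P (\<Pi>\<^sub>M i\<in>{1..n}. borel)"
    by (simp cong: measurable_cong_sets add: sets_PiM_lborel del: One_nat_def)
  have D: "?D \<in> sets ?P"
    unfolding sets_PiM_lborel by (rule simplex_chart_domain_sets)
  have D_ind: "indicator ?D r = (indicator (solid_simplex {1..<n} 1) r :: ennreal)"
    if "r \<in> space ?P" for r
    using that by (simp add: indicator_def simplex_chart_in_prob_simplex_iff[OF n] space_PiM)
  have split: "geometric_fps (x n) * (\<Prod>i\<in>{1..<n}. geometric_fps (x i)) =
        (\<Prod>i\<in>{1..n}. geometric_fps (x i))"
  proof -
    have *: "{1..n} = insert n {1..<n}" using n by auto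
    show ?thesis unfolding * by simp
  qed
  have key: "(\<integral>\<^sup>+ r. ennreal ((\<Sum>i\<in>{1..n}. simplex_chart n r i * x i) ^ k / fact k) * indicator ?D r \<partial>?P)
       = ennreal (1 / fact (n - 1 + k) * ?h k)" for k
  proof -
    have "(\<integral>\<^sup>+ r. ennreal ((\<Sum>i\<in>{1..n}. simplex_chart n r i * x i) ^ k / fact k) * indicator ?D r \<partial>?P) =
       (\<integral>\<^sup>+ r. ennreal (((1 - (\<Sum>i\<in>{1..<n}. r i)) * x n + (\<Sum>i\<in>{1..<n}. r i * x i)) ^ k / fact k) *
          indicator (solid_simplex {1..<n} 1) r \<partial>?P)"
      by (intro nn_integral_cong) (simp only: D_ind sum_simplex_chart[OF n, of "\<lambda>u i. u * x i"])
    also have "\<dots> = ennreal (1 / fact (n - 1 + k) * ?h k)"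
      using n by (subst nn_integral_solid_simplex_power) (auto simp: split x simp del: One_nat_def)
    finally show ?thesis .
  qed
  have vol: "emeasure ?P ?D = ennreal (1 / fact (n - 1))"
    using key[of 0] D by (simp add: fps_nth_0_prod)
  have "(\<integral>\<^sup>+ r. ennreal ((\<Sum>i\<in>{1..n}. r i * x i) ^ k) \<partial>dirichlet_ones n) =
        (\<integral>\<^sup>+ r. ennreal ((\<Sum>i\<in>{1..n}. simplex_chart n r i * x i) ^ k) * indicator ?D r
            \<partial>?P) / emeasure ?P ?D"
    unfolding dirichlet_ones_def using chart D
    by (simp add: nn_integral_distr nn_integral_uniform_measure)
  also have "(\<integral>\<^sup>+ r. ennreal ((\<Sum>i\<in>{1..n}. simplex_chart n r i * x i) ^ k) * indicator ?D r \<partial>?P) =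
     (\<integral>\<^sup>+ r. ennreal (fact k) * (ennreal ((\<Sum>i\<in>{1..n}. simplex_chart n r i * x i) ^ k / fact k) *
         indicator ?D r) \<partial>?P)"
    by (intro nn_integral_cong) (simp add: mult.assoc[symmetric] ennreal_mult'[symmetric])
  also have "\<dots> = ennreal (fact k) * ennreal (1 / fact (n - 1 + k) * ?h k)"
    using chart D by (subst nn_integral_cmult) (simp_all only: key, measurable)
  also have "\<dots> / emeasure ?P ?D = ennreal (fact k * fact (n - 1) / fact (n - 1 + k) * ?h k)"
  proof -
    have "0 \<le> ?h k" using x by (intro fps_nth_prod_nonneg) auto
    moreover have "ennreal (fact k) * ennreal (1 / fact (n - 1 + k) * c) / ennreal (1 / fact (n - 1)) =
        ennreal (fact k * fact (n - 1) / fact (n - 1 + k) * c)" if "0 \<le> c" for c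
      using that by (subst ennreal_mult[symmetric]) (simp_all add: divide_ennreal mult_ac)
    ultimately show ?thesis unfolding vol by blast
  qed
  finally show ?thesis .
qed

section \<open>Expected products of geometric series\<close>

lemma measurable_fps_nth_prod_geometric:
  assumes g [measurable]: "g \<in> borel_measurable M" and "finite K" "K \<subseteq> J"
  shows "(\<lambda>x. fps_nth (\<Prod>i\<in>K. geometric_fps (g (x i))) k) \<in> borel_measurable (\<Pi>\<^sub>M i\<in>J. M)"
  using assms(2,3)
proof (induction K arbitrary: k rule: finite_induct)
  case (insert l K)
  then have [measurable]: "(\<lambda>x. x l) \<in> measurable (\<Pi>\<^sub>M i\<in>J. M) M"
    by (intro measurable_component_singleton) auto
  have [measurable]: "(\<lambda>x. fps_nth (\<Prod>i\<in>K. geometric_fps (g (x i))) k)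
      \<in> borel_measurable (\<Pi>\<^sub>M i\<in>J. M)" for k
    using insert by auto
  show ?case using insert.hyps by (simp add: fps_mult_nth)
qed simp

text \<open>Independence turns the expectation of a product of random power series into the product of
the expected power series, coefficient by coefficient.\<close>
lemma (in prob_space) nn_integral_prod_geometric:
  fixes g :: "'a \<Rightarrow> real"
  assumes [measurable]: "g \<in> borel_measurable M" and g: "\<And>x. x \<in> space M \<Longrightarrow> g x \<in> {0..1}"
    and "finite I"
  shows "(\<integral>\<^sup>+ x. ennreal (fps_nth (\<Prod>i\<in>I. geometric_fps (g (x i))) k) \<partial>(\<Pi>\<^sub>M i\<in>I. M)) =
         ennreal (fps_nth (Abs_fps (\<lambda>k. expectation (\<lambda>x. g x ^ k)) ^ card I) k)"
  using assms(3)
proof (induction I arbitrary: k rule: finite_induct)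
  case empty
  then show ?case by (simp add: PiM_empty nn_integral_count_space_finite)
next
  case (insert i I)
  interpret product_sigma_finite "\<lambda>_. M" ..
  let ?F = "Abs_fps (\<lambda>k. expectation (\<lambda>x. g x ^ k))"
  let ?h = "\<lambda>I k x. fps_nth (\<Prod>i\<in>I. geometric_fps (g (x i))) k"
  have [measurable]: "(\<lambda>x. ?h J k x) \<in> borel_measurable (\<Pi>\<^sub>M i\<in>J. M)" if "finite J" for J k
    using that by (intro measurable_fps_nth_prod_geometric) auto
  have int: "integrable M (\<lambda>x. g x ^ j)" for j
    using g by (intro integrable_const_bound[where B = 1]) (auto simp: power_le_one)
  have moment: "(\<integral>\<^sup>+ y. ennreal (g y ^ j) \<partial>M) = ennreal (expectation (\<lambda>x. g x ^ j))" for j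
    using int g by (intro nn_integral_eq_integral) auto
  have F_nonneg: "0 \<le> fps_nth (?F ^ m) j" for m j
    using fps_nth_prod_nonneg[of "{..<m}" "\<lambda>_. ?F" j] g
    by (simp add: integral_nonneg_AE)
  have "(\<integral>\<^sup>+ x. ennreal (?h (insert i I) k x) \<partial>(\<Pi>\<^sub>M i\<in>insert i I. M)) =
        (\<integral>\<^sup>+ y. \<integral>\<^sup>+ x. ennreal (?h (insert i I) k (x(i := y))) \<partial>(\<Pi>\<^sub>M i\<in>I. M) \<partial>M)"
    using insert.hyps by (intro product_nn_integral_insert_rev)
        (simp_all only: finite_insert, measurable)
  also have "\<dots> = (\<integral>\<^sup>+ y. \<integral>\<^sup>+ x. (\<Sum>j\<le>k. ennreal (g y ^ j) * ennreal (?h I (k - j) x)) \<partial>(\<Pi>\<^sub>M i\<in>I. M) \<partial>M)"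
  proof (intro nn_integral_cong)
    fix y x assume "y \<in> space M" "x \<in> space (\<Pi>\<^sub>M i\<in>I. M)"
    then have nn: "0 \<le> g y" "\<And>i. i \<in> I \<Longrightarrow> 0 \<le> g (x i)"
      using g by (auto simp: space_PiM dest!: PiE_mem)
    have "(\<Prod>l\<in>I. geometric_fps (g ((x(i := y)) l))) = (\<Prod>l\<in>I. geometric_fps (g (x l)))"
      using insert.hyps by (intro prod.cong) auto
    then have "?h (insert i I) k (x(i := y)) = (\<Sum>j\<le>k. g y ^ j * ?h I (k - j) x)"
      using insert.hyps by (simp add: fps_mult_nth atMost_atLeast0)
    then show "ennreal (?h (insert i I) k (x(i := y))) = (\<Sum>j\<le>k. ennreal (g y ^ j) *
        ennreal (?h I (k - j) x))"
      using nn by (simp add: ennreal_mult[symmetric] fps_nth_prod_nonneg)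
  qed
  also have "\<dots> = (\<Sum>j\<le>k. ennreal (expectation (\<lambda>x. g x ^ j)) * ennreal (fps_nth (?F ^ card I) (k - j)))"
    using insert.hyps
    by (simp add: nn_integral_sum nn_integral_cmult nn_integral_multc insert.IH moment)
  also have "\<dots> = ennreal (\<Sum>j\<le>k. fps_nth ?F j * fps_nth (?F ^ card I) (k - j))"
    using g F_nonneg
    by (subst sum_ennreal[symmetric])
       (auto simp: ennreal_mult[symmetric] integral_nonneg_AE)
  also have "(\<Sum>j\<le>k. fps_nth ?F j * fps_nth (?F ^ card I) (k - j)) = fps_nth (?F ^ card (insert i I)) k"
    using insert.hyps by (simp add: fps_mult_nth atMost_atLeast0)
  finally show ?case .
qed

section \<open>Roots of power series and the binomial series\<close>

text \<open>In \<open>F\<^sup>n - G\<^sup>n = (F - G) (\<Sum>p<n. F\<^sup>p G\<^sup>n\<^sup>-\<^sup>1\<^sup>-\<^sup>p)\<close> the second factor has constant term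
\<open>n\<close>, hence is not a zero divisor.\<close>
lemma fps_power_eq_imp_eq:
  fixes F G :: "real fps"
  assumes "F ^ n = G ^ n" "0 < n" "fps_nth F 0 = 1" "fps_nth G 0 = 1"
  shows "F = G"
proof -
  obtain m where n: "n = Suc m" using assms(2) gr0_implies_Suc by blast
  let ?Q = "\<Sum>p<Suc m. F ^ p * G ^ (m - p)"
  have "(F - G) * ?Q = 0"
    using diff_power_eq_sum[of F m G] assms(1) n by simp
  moreover have "fps_nth ?Q 0 = real (Suc m)"
    by (simp add: fps_sum_nth assms fps_nth_power_0 del: sum.lessThan_Suc)
  then have "?Q \<noteq> 0" by (metis fps_zero_nth of_nat_neq_0)
  ultimately show ?thesis by (simp del: sum.lessThan_Suc)
qed

text \<open>The binomial series of \<open>(1 - t)\<close> to the power \<open>- a\<close>.\<close>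
definition rising_fps :: "real \<Rightarrow> real fps" where
  "rising_fps a = Abs_fps (\<lambda>k. pochhammer a k / fact k)"

text \<open>The Chu-Vandermonde identity for rising factorials.\<close>
lemma rising_fps_add: "rising_fps (a + b) = rising_fps a * rising_fps b"
  by (rule fps_ext)
     (simp add: rising_fps_def fps_mult_nth pochhammer_binomial_sum sum_divide_distrib
        binomial_fact atMost_atLeast0 field_simps)

lemma rising_fps_power: "rising_fps a ^ n = rising_fps (real n * a)"
proof (induction n)
  case 0
  show ?case by (rule fps_ext) (simp add: rising_fps_def pochhammer_0_left)
next
  case (Suc n)
  then show ?case by (simp add: rising_fps_add[symmetric] algebra_simps)
qed

section \<open>Moments determine laws with bounded support\<close>

text \<open>For a law carried by \<open>[- b, b]\<close> the Taylor remainder of order \<open>n\<close> of the characteristic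
function is at most \<open>2 (\<bar>t\<bar> b)\<^sup>n / n!\<close>, so the moments determine the characteristic function
and thus the law.\<close>
lemma real_distribution_eqI_moments:
  assumes "real_distribution M" "real_distribution N"
    and bM: "AE x in M. \<bar>x\<bar> \<le> b" and bN: "AE x in N. \<bar>x\<bar> \<le> b"
    and moments: "\<And>k. (\<integral>x. x ^ k \<partial>M) = (\<integral>x. x ^ k \<partial>N)"
  shows "M = N"
proof (rule Levy_uniqueness[OF assms(1,2)], rule ext)
  fix t
  have approx: "cmod (char M t - (\<Sum>k\<le>n. ((\<i> * t)^k / fact k) * (\<integral>x. x ^ k \<partial>M)))
      \<le> 2 * ((\<bar>t\<bar> * b) ^ n / fact n)" 
    if "real_distribution M" and bM: "AE x in M. \<bar>x\<bar> \<le> b" for M n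
  proof -
    interpret real_distribution M by fact
    have int: "integrable M (\<lambda>x. x ^ k)" for k
      using bM by (intro integrable_const_bound[where B = "b ^ k"])
        (auto elim!: eventually_mono simp: power_abs intro!: power_mono)
    have "expectation (\<lambda>x. \<bar>x\<bar> ^ n) \<le> expectation (\<lambda>x. b ^ n)"
    proof (rule integral_mono_AE)
      show "integrable M (\<lambda>x. \<bar>x\<bar> ^ n)"
        using integrable_abs[OF int[of n]] by (simp add: power_abs)
      show "AE x in M. \<bar>x\<bar> ^ n \<le> b ^ n"
        using bM by (elim eventually_mono) (auto intro: power_mono)
    qed simp
    then have "2 * \<bar>t\<bar> ^ n / fact n * expectation (\<lambda>x. \<bar>x\<bar> ^ n) \<le> 2 * \<bar>t\<bar> ^ n / fact n * b ^ n"
      using prob_space by (intro mult_left_mono) (auto simp: space_eq_univ)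
    with char_approx1[of n t] int show ?thesis
      by (simp add: power_mult_distrib)
  qed
  have "cmod (char M t - char N t) \<le> 4 * ((\<bar>t\<bar> * b) ^ n / fact n)" for n
  proof -
    let ?p = "\<Sum>k\<le>n. ((\<i> * t)^k / fact k) * (\<integral>x. x ^ k \<partial>M)"
    have "cmod (char M t - char N t) \<le> cmod (char M t - ?p) + cmod (char N t - ?p)"
      using norm_triangle_ineq4[of "char M t - ?p" "char N t - ?p"] by simp
    then show ?thesis
      using approx[OF assms(1) bM, of n] approx[OF assms(2) bN, of n]
      unfolding moments by linarith
  qed
  moreover have "(\<lambda>n. 4 * ((\<bar>t\<bar> * b) ^ n / fact n)) \<longlonglongrightarrow> 4 * 0"
    using summable_LIMSEQ_zero[OF summable_exp[of "\<bar>t\<bar> * b"]]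
    by (intro tendsto_mult tendsto_const) (simp add: divide_inverse mult.commute)
  ultimately have "cmod (char M t - char N t) \<le> 4 * 0"
    by (intro tendsto_lowerbound[of _ _ sequentially]) auto
  then show "char M t = char N t" by simp
qed

section \<open>Moments of Beta laws\<close>

lemma beta_density_nonneg: "0 < p \<Longrightarrow> 0 < q \<Longrightarrow> 0 \<le> beta_density p q x"
  by (auto simp: beta_density_def
      intro!: mult_nonneg_nonneg divide_nonneg_nonneg Gamma_real_pos less_imp_le)

lemma measurable_beta_density [measurable]: "beta_density p q \<in> borel_measurable borel"
  unfolding beta_density_def by measurable

text \<open>Multiplying the density by \<open>x ^ k\<close> shifts \<open>p\<close> to \<open>p + k\<close>, so the moment is a quotient
of two Beta functions.\<close>
lemma nn_integral_beta_density_power: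
  assumes p: "0 < p" and q: "0 < q"
  shows "(\<integral>\<^sup>+ x. ennreal (beta_density p q x * x ^ k) \<partial>lborel) =
           ennreal (pochhammer p k / pochhammer (p + q) k)"
proof (rule nn_integral_has_integral_lborel)
  let ?c = "Gamma (p + q) / (Gamma p * Gamma q)"
  have Gamma_nonzero: "Gamma q \<noteq> 0"
    using Gamma_real_pos[OF q] by simp
  have nonpos: "p \<notin> \<int>\<^sub>\<le>\<^sub>0" "p + q \<notin> \<int>\<^sub>\<le>\<^sub>0"
    using p q by (auto elim!: nonpos_Ints_cases)
  have "((\<lambda>x. x powr (p + real k - 1) * (1 - x) powr (q - 1))
      has_integral Beta (p + real k) q) {0<..<1}"
    using has_integral_Beta_real[of "p + real k" q] p q by (simp add: has_integral_Icc_iff_Ioo)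
  then have "((\<lambda>x. ?c * (x powr (p + real k - 1) * (1 - x) powr (q - 1))) has_integral ?c *
      Beta (p + real k) q) {0<..<1}"
    by (rule has_integral_mult_right)
  then have "((\<lambda>x. if x \<in> {0<..<1} then ?c * (x powr (p + real k - 1) * (1 - x) powr (q - 1)) else 0)
      has_integral ?c * Beta (p + real k) q) UNIV"
    by (simp only: has_integral_restrict_UNIV)
  also have "(\<lambda>x. if x \<in> {0<..<1} then ?c * (x powr (p + real k - 1) * (1 - x) powr (q - 1)) else 0) =
      (\<lambda>x. beta_density p q x * x ^ k)"
  proof
    fix x :: real
    have "x powr (p + real k - 1) = x powr (p - 1) * x ^ k" if "0 < x"
      using that by (simp add: powr_realpow[symmetric] powr_add[symmetric] algebra_simps)
    then show "(if x \<in> {0<..<1} then ?c * (x powr (p + real k - 1) * (1 - x) powr (q - 1)) else 0) =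
        beta_density p q x * x ^ k"
      by (auto simp: beta_density_def)
  qed
  also have "?c * Beta (p + real k) q = pochhammer p k / pochhammer (p + q) k"
    using Gamma_nonzero by (simp add: Beta_def pochhammer_Gamma nonpos add.assoc add.commute[of q])
  finally show "((\<lambda>x. beta_density p q x * x ^ k) has_integral
      pochhammer p k / pochhammer (p + q) k) UNIV" .
next
  show "0 \<le> beta_density p q x * x ^ k" for x
    using beta_density_nonneg[OF p q, of x] by (cases "0 < x") (auto simp: beta_density_def)
qed measurable

definition std_beta :: "real \<Rightarrow> real \<Rightarrow> real measure" where
  "std_beta p q = density lborel (\<lambda>x. ennreal (beta_density p q x))"

lemma
  assumes p: "0 < p" and q: "0 < q"
  shows real_distribution_std_beta: "real_distribution (std_beta p q)"
    and AE_std_beta: "AE x in std_beta p q. x \<in> {0<..<1}"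
    and integral_std_beta_power: "(\<integral>x. x ^ k \<partial>std_beta p q) = pochhammer p k / pochhammer (p + q) k"
proof -
  show AE: "AE x in std_beta p q. x \<in> {0<..<1}"
    unfolding std_beta_def by (subst AE_density) (auto simp: beta_density_def)
  have "emeasure (std_beta p q) (space (std_beta p q)) = 1"
    using nn_integral_beta_density_power[OF p q, of 0]
    by (simp add: std_beta_def emeasure_density)
  then show "real_distribution (std_beta p q)"
    by (auto simp: real_distribution_def real_distribution_axioms_def std_beta_def intro: prob_spaceI)
  have "(\<integral>x. x ^ k \<partial>std_beta p q) = enn2real (\<integral>\<^sup>+ x. ennreal (x ^ k) \<partial>std_beta p q)"
    using AE by (intro integral_eq_nn_integral) (auto simp: std_beta_def elim!: eventually_mono)
  also have "(\<integral>\<^sup>+ x. ennreal (x ^ k) \<partial>std_beta p q) = (\<integral>\<^sup>+ x. ennreal (beta_density p q x * x ^ k)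
      \<partial>lborel)"
    by (simp add: std_beta_def nn_integral_density ennreal_mult'[symmetric] beta_density_nonneg p q)
  also have "\<dots> = ennreal (pochhammer p k / pochhammer (p + q) k)"
    by (rule nn_integral_beta_density_power[OF p q])
  finally show "(\<integral>x. x ^ k \<partial>std_beta p q) = pochhammer p k / pochhammer (p + q) k"
    using p q by (simp add: pochhammer_nonneg)
qed

lemma std_beta_eq_iff_moments:
  assumes p: "0 < p" and q: "0 < q" and N: "real_distribution N" and b: "AE x in N. x \<in> {0..1}"
  shows "N = std_beta p q \<longleftrightarrow> (\<forall>k. (\<integral>x. x ^ k \<partial>N) = pochhammer p k / pochhammer (p + q) k)"
proof
  assume "\<forall>k. (\<integral>x. x ^ k \<partial>N) = pochhammer p k / pochhammer (p + q) k"
  moreover have "AE x in N. \<bar>x\<bar> \<le> 1"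
    using b by (elim eventually_mono) auto
  moreover have "AE x in std_beta p q. \<bar>x\<bar> \<le> 1"
    using AE_std_beta[OF p q] by (elim eventually_mono) auto
  ultimately show "N = std_beta p q"
    by (intro real_distribution_eqI_moments[OF N real_distribution_std_beta[OF p q], where b = 1])
       (auto simp: integral_std_beta_power[OF p q])
qed (simp add: integral_std_beta_power[OF p q])

text \<open>Non-degenerate affine maps can be undone, so laws may be compared after rescaling.\<close>
lemma distr_affine_cancel:
  fixes A B :: "real measure"
  assumes A: "sets A = sets borel" and B: "sets B = sets borel" and h: "h \<noteq> 0"
    and eq: "distr A borel (\<lambda>x. c + h * x) = distr B borel (\<lambda>x. c + h * x)"
  shows "A = B"
proof -
  have "distr (distr N borel (\<lambda>x. c + h * x)) borel (\<lambda>y. (y - c) / h) = N"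
    if N: "sets N = sets borel" for N :: "real measure"
  proof -
    have [measurable]: "(\<lambda>x. c + h * x) \<in> borel_measurable N"
      by (simp cong: measurable_cong_sets add: N)
    have "distr (distr N borel (\<lambda>x. c + h * x)) borel (\<lambda>y. (y - c) / h) = distr N borel (\<lambda>x. x)"
      using h by (subst distr_distr) (simp_all add: comp_def)
    also have "\<dots> = N"
      using N by (intro distr_id2) simp
    finally show ?thesis .
  qed
  from this[OF A] this[OF B] eq show ?thesis by metis
qed

section \<open>Averages of independent variables with Dirichlet weights\<close>

text \<open>The random variables are averaged after a map \<open>g\<close> into the unit interval. In the application
\<open>g\<close> rescales \<open>(- a, a)\<close> to \<open>(0, 1)\<close> and is clamped elsewhere; then its values are
nonnegative and bounded at every point, not just almost everywhere.\<close>
locale dirichlet_average = prob_space M for M :: "'b measure" +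
  fixes X R :: "nat \<Rightarrow> 'b \<Rightarrow> real" and \<mu> :: "real measure" and n :: nat and g :: "real \<Rightarrow> real"
  assumes n: "1 \<le> n"
    and indep_X: "indep_vars (\<lambda>_. borel) X {1..n}"
    and distr_X: "\<And>i. i \<in> {1..n} \<Longrightarrow> distr M borel (X i) = \<mu>"
    and distr_R: "distr M (\<Pi>\<^sub>M i\<in>{1..n}. borel) (\<lambda>\<omega>. \<lambda>i\<in>{1..n}. R i \<omega>) = dirichlet_ones n"
    and indep_RX: "indep_var
           (\<Pi>\<^sub>M i\<in>{1..n}. borel) (\<lambda>\<omega>. \<lambda>i\<in>{1..n}. R i \<omega>)
           (\<Pi>\<^sub>M i\<in>{1..n}. borel) (\<lambda>\<omega>. \<lambda>i\<in>{1..n}. X i \<omega>)"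
    and g_measurable [measurable]: "g \<in> borel_measurable borel"
    and g_range: "\<And>x. g x \<in> {0..1}"
begin

definition average :: "'b \<Rightarrow> real" where
  "average \<omega> = (\<Sum>i\<in>{1..n}. R i \<omega> * g (X i \<omega>))"

lemma measurable_X: "i \<in> {1..n} \<Longrightarrow> X i \<in> borel_measurable M"
  using indep_X by (auto simp: indep_vars_def)

lemma measurable_weights:
  "(\<lambda>\<omega>. \<lambda>i\<in>{1..n}. R i \<omega>) \<in> measurable M (\<Pi>\<^sub>M i\<in>{1..n}. borel)"
  using indep_RX by (rule indep_var_rv1)

lemma measurable_R:
  assumes "i \<in> {1..n}"
  shows "R i \<in> borel_measurable M"
proof -
  have "(\<lambda>\<omega>. (\<lambda>i\<in>{1..n}. R i \<omega>) i) \<in> borel_measurable M"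
    using measurable_compose[OF measurable_weights measurable_component_singleton[OF assms]] .
  then show ?thesis using assms by simp
qed

lemma measurable_average [measurable]: "average \<in> borel_measurable M"
  unfolding average_def using measurable_X measurable_R
  by (intro borel_measurable_sum borel_measurable_times measurable_compose[OF _ g_measurable]) auto

lemma AE_weights: "AE \<omega> in M. (\<lambda>i\<in>{1..n}. R i \<omega>) \<in> prob_simplex n"
proof -
  have "AE r in distr M (\<Pi>\<^sub>M i\<in>{1..n}. borel) (\<lambda>\<omega>. \<lambda>i\<in>{1..n}. R i \<omega>). r \<in> prob_simplex n"
    unfolding distr_R by (rule AE_dirichlet_ones)
  then show ?thesis
    using prob_simplex_sets[of n] by (subst (asm) AE_distr_iff[OF measurable_weights])
        (simp_all del: One_nat_def add: Int_def[symmetric] sets.Int)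
qed

lemma AE_average: "AE \<omega> in M. average \<omega> \<in> {0..1}"
  using AE_weights
proof eventually_elim
  case (elim \<omega>)
  then have R: "\<And>i. i \<in> {1..n} \<Longrightarrow> 0 \<le> R i \<omega>" and sum: "(\<Sum>i\<in>{1..n}. R i \<omega>) = 1"
    by (simp_all add: prob_simplex_def)
  have "average \<omega> \<le> (\<Sum>i\<in>{1..n}. R i \<omega> * 1)"
    unfolding average_def using R g_range by (intro sum_mono mult_left_mono) auto
  moreover have "0 \<le> average \<omega>"
    unfolding average_def using R g_range by (intro sum_nonneg mult_nonneg_nonneg) auto
  ultimately show ?case using sum by simp
qed

lemma prob_space_law: "prob_space \<mu>"
  using prob_space_distr[OF measurable_X[of 1]] distr_X[of 1] n by simp

lemma sets_law: "sets \<mu> = sets borel"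
  using distr_X[of 1] n by (metis atLeastAtMost_iff le_refl sets_distr)

lemma joint_law:
  "distr M ((\<Pi>\<^sub>M i\<in>{1..n}. borel) \<Otimes>\<^sub>M (\<Pi>\<^sub>M i\<in>{1..n}. borel))
     (\<lambda>\<omega>. (\<lambda>i\<in>{1..n}. R i \<omega>, \<lambda>i\<in>{1..n}. X i \<omega>)) = dirichlet_ones n \<Otimes>\<^sub>M (\<Pi>\<^sub>M i\<in>{1..n}. \<mu>)"
proof -
  have "distr M (\<Pi>\<^sub>M i\<in>{1..n}. borel) (\<lambda>\<omega>. \<lambda>i\<in>{1..n}. X i \<omega>) = (\<Pi>\<^sub>M i\<in>{1..n}. distr M borel (X i))"
    using indep_X n measurable_X by (subst (asm) indep_vars_iff_distr_eq_PiM') auto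
  also have "\<dots> = (\<Pi>\<^sub>M i\<in>{1..n}. \<mu>)"
    using distr_X by (intro PiM_cong) auto
  finally show ?thesis
    using indep_RX distr_R by (simp add: indep_var_distribution_eq)
qed

text \<open>The moment form of the identity \<open>E (1 - t T)\<^sup>-\<^sup>n = (E (1 - t g(X))\<^sup>-\<^sup>1)\<^sup>n\<close>, where
\<open>T\<close> denotes the average: integrate over the weights first, for fixed values of \<open>X\<close>, and
then over \<open>X\<close>.\<close>
lemma expectation_average_power:
  "expectation (\<lambda>\<omega>. average \<omega> ^ k) =
     fact k * fact (n - 1) / fact (n - 1 + k) * fps_nth (Abs_fps (\<lambda>k. \<integral>x. g x ^ k \<partial>\<mu>) ^ n) k"
proof -
  interpret \<mu>: prob_space \<mu> by (rule prob_space_law)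
  let ?B = "\<Pi>\<^sub>M i\<in>{1..n}. borel :: real measure"
  let ?X = "\<Pi>\<^sub>M i\<in>{1..n}. \<mu>"
  let ?F = "Abs_fps (\<lambda>k. \<integral>x. g x ^ k \<partial>\<mu>)"
  let ?c = "fact k * fact (n - 1) / fact (n - 1 + k) :: real"
  let ?f = "\<lambda>(r, x). ennreal ((\<Sum>i\<in>{1..n}. r i * g (x i)) ^ k)"
  interpret D: prob_space "dirichlet_ones n"
    unfolding distr_R[symmetric] by (rule prob_space_distr[OF measurable_weights])
  interpret PX: prob_space ?X by (intro prob_space_PiM prob_space_law)
  interpret pair_sigma_finite "dirichlet_ones n" ?X ..
  have sets_X: "sets ?X = sets ?B"
    by (intro sets_PiM_cong) (auto simp: sets_law)
  have comp: "(\<lambda>z. f z i) \<in> borel_measurable N" if "f \<in> measurable N ?B" "i \<in> {1..n}"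
      for f i and N :: "'c measure"
    using measurable_compose[OF that(1) measurable_component_singleton[OF that(2)]] .
  have f: "?f \<in> borel_measurable (?B \<Otimes>\<^sub>M ?B)"
    unfolding case_prod_beta
    by (intro measurable_compose[OF _ measurable_ennreal] borel_measurable_power borel_measurable_sum
          borel_measurable_times measurable_compose[OF _ g_measurable] comp) auto
  have f': "?f \<in> borel_measurable (dirichlet_ones n \<Otimes>\<^sub>M ?X)"
    using f unfolding measurable_cong_sets[OF sets_pair_measure_cong[OF sets_dirichlet_ones sets_X]
        refl] .
  have pair: "(\<lambda>\<omega>. (\<lambda>i\<in>{1..n}. R i \<omega>, \<lambda>i\<in>{1..n}. X i \<omega>)) \<in> measurable M (?B \<Otimes>\<^sub>M ?B)"
    using measurable_weights indep_var_rv2[OF indep_RX] by (rule measurable_Pair)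
  have F_nonneg: "0 \<le> fps_nth (?F ^ n) k"
    using fps_nth_prod_nonneg[of "{..<n}" "\<lambda>_. ?F" k] g_range
    by (simp add: integral_nonneg_AE)
  have "(\<integral>\<^sup>+\<omega>. ennreal (average \<omega> ^ k) \<partial>M) =
      (\<integral>\<^sup>+\<omega>. ?f (\<lambda>i\<in>{1..n}. R i \<omega>, \<lambda>i\<in>{1..n}. X i \<omega>) \<partial>M)"
    by (simp add: average_def)
  also have "\<dots> = (\<integral>\<^sup>+z. ?f z \<partial>(dirichlet_ones n \<Otimes>\<^sub>M ?X))"
    unfolding joint_law[symmetric] using f by (subst nn_integral_distr[OF pair]) simp_all
  also have "\<dots> = (\<integral>\<^sup>+x. \<integral>\<^sup>+r. ennreal ((\<Sum>i\<in>{1..n}. r i * g (x i)) ^ k) \<partial>dirichlet_ones n \<partial>?X)"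
    by (subst nn_integral_snd[OF f', symmetric]) simp
  also have "\<dots> = (\<integral>\<^sup>+x. ennreal ?c * ennreal (fps_nth (\<Prod>i\<in>{1..n}. geometric_fps (g (x i))) k) \<partial>?X)"
  proof (intro nn_integral_cong)
    fix x
    have "(\<integral>\<^sup>+r. ennreal ((\<Sum>i\<in>{1..n}. r i * g (x i)) ^ k) \<partial>dirichlet_ones n) =
        ennreal (?c * fps_nth (\<Prod>i\<in>{1..n}. geometric_fps (g (x i))) k)"
      by (rule nn_integral_dirichlet_ones_power[OF n]) (use g_range in auto)
    also have "\<dots> = ennreal ?c * ennreal (fps_nth (\<Prod>i\<in>{1..n}. geometric_fps (g (x i))) k)"
      by (rule ennreal_mult') simp
    finally show "(\<integral>\<^sup>+r. ennreal ((\<Sum>i\<in>{1..n}. r i * g (x i)) ^ k) \<partial>dirichlet_ones n) = \<dots>" .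
  qed
  also have "\<dots> = ennreal ?c * ennreal (fps_nth (?F ^ n) k)"
  proof -
    have m: "g \<in> borel_measurable \<mu>"
      using g_measurable by (simp cong: measurable_cong_sets add: sets_law)
    from \<mu>.nn_integral_prod_geometric[OF m, of "{1..n}" k] g_range
    have "(\<integral>\<^sup>+x. ennreal (fps_nth (\<Prod>i\<in>{1..n}. geometric_fps (g (x i))) k) \<partial>?X) =
        ennreal (fps_nth (?F ^ n) k)"
      by simp
    then show ?thesis
      using measurable_fps_nth_prod_geometric[OF m, of "{1..n}" "{1..n}" k]
      by (subst nn_integral_cmult) auto
  qed
  also have "\<dots> = ennreal (?c * fps_nth (?F ^ n) k)"
    by (rule ennreal_mult'[symmetric]) simp
  finally have *: "(\<integral>\<^sup>+\<omega>. ennreal (average \<omega> ^ k) \<partial>M) = ennreal (?c * fps_nth (?F ^ n) k)" .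
  have "expectation (\<lambda>\<omega>. average \<omega> ^ k) = enn2real (\<integral>\<^sup>+\<omega>. ennreal (average \<omega> ^ k) \<partial>M)"
    using AE_average by (intro integral_eq_nn_integral) (auto elim!: eventually_mono)
  then show ?thesis using F_nonneg by (simp add: *)
qed

text \<open>The moment series of \<open>Beta(\<alpha>, 1 - \<alpha>)\<close> is \<open>rising_fps \<alpha>\<close> because the two parameters add up
to \<open>1\<close>. Its \<open>n\<close>-th power \<open>rising_fps (n \<alpha>)\<close> is, after division by the binomial
coefficients \<open>n + k - 1\<close> choose \<open>k\<close>, the moment sequence of \<open>Beta(n \<alpha>, n (1 - \<alpha>))\<close>. Every step is an
equivalence: moments determine laws on \<open>[0, 1]\<close>, and \<open>n\<close>-th roots of power series with
constant term \<open>1\<close> are unique.\<close>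
theorem average_std_beta_iff:
  assumes \<alpha>: "0 < \<alpha>" "\<alpha> < 1"
  shows "distr M borel average = std_beta (real n * \<alpha>) (real n * (1 - \<alpha>)) \<longleftrightarrow>
         distr \<mu> borel g = std_beta \<alpha> (1 - \<alpha>)"
proof -
  interpret \<mu>: prob_space \<mu> by (rule prob_space_law)
  have [measurable]: "g \<in> borel_measurable \<mu>"
    using g_measurable by (simp cong: measurable_cong_sets add: sets_law)
  let ?F = "Abs_fps (\<lambda>k. \<integral>x. g x ^ k \<partial>\<mu>)"
  have "distr \<mu> borel g = std_beta \<alpha> (1 - \<alpha>) \<longleftrightarrow>
      (\<forall>k. (\<integral>x. x ^ k \<partial>distr \<mu> borel g) = pochhammer \<alpha> k / pochhammer (\<alpha> + (1 - \<alpha>)) k)"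
    using \<alpha> g_range by (intro std_beta_eq_iff_moments real_distribution_distr)
      (auto simp: AE_distr_iff)
  also have "\<dots> \<longleftrightarrow> ?F = rising_fps \<alpha>"
    by (simp add: fps_eq_iff rising_fps_def integral_distr pochhammer_fact)
  also have "\<dots> \<longleftrightarrow> ?F ^ n = rising_fps (real n * \<alpha>)"
    unfolding rising_fps_power[symmetric]
    using n fps_power_eq_imp_eq[of ?F n "rising_fps \<alpha>"] by (auto simp: rising_fps_def \<mu>.prob_space)
  also have "\<dots> \<longleftrightarrow> (\<forall>k. (\<integral>x. x ^ k \<partial>distr M borel average) =
      pochhammer (real n * \<alpha>) k / pochhammer (real n * \<alpha> + real n * (1 - \<alpha>)) k)"
  proof -
    have "fps_nth (?F ^ n) k = fps_nth (rising_fps (real n * \<alpha>)) k \<longleftrightarrow>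
        (\<integral>x. x ^ k \<partial>distr M borel average) =
          pochhammer (real n * \<alpha>) k / pochhammer (real n * \<alpha> + real n * (1 - \<alpha>)) k" for k
    proof -
      have "fact (n - 1 + k) = fact (n - 1) * pochhammer (real n) k"
        using n pochhammer_product'[of "1 :: real" "n - 1" k]
        by (simp add: pochhammer_fact of_nat_diff)
      then have "(\<integral>x. x ^ k \<partial>distr M borel average) = fact k / pochhammer (real n) k *
          fps_nth (?F ^ n) k"
        by (simp add: integral_distr expectation_average_power)
      moreover have "real n * \<alpha> + real n * (1 - \<alpha>) = real n" by (simp add: algebra_simps)
      moreover have "pochhammer (real n) k \<noteq> 0"
        using n pochhammer_pos[of "real n" k] by simp
      ultimately show ?thesis by (simp add: rising_fps_def field_simps)
    qed
    then show ?thesis by (simp add: fps_eq_iff)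
  qed
  also have "\<dots> \<longleftrightarrow> distr M borel average = std_beta (real n * \<alpha>) (real n * (1 - \<alpha>))"
    using \<alpha> n AE_average
    by (intro std_beta_eq_iff_moments[symmetric] real_distribution_distr) (auto simp: AE_distr_iff)
  finally show ?thesis ..
qed

end

section \<open>The characterization\<close>

theorem theorem3p3:
  fixes M :: "'b measure"
    and X R :: "nat \<Rightarrow> 'b \<Rightarrow> real"
    and \<mu> :: "real measure"
    and n :: nat and a \<alpha> :: real
  assumes "prob_space M"
    and "n \<ge> 2" and "a > 0" and "0 < \<alpha>" and "\<alpha> < 1"
    and "prob_space.indep_vars M (\<lambda>_. borel) X {1..n}"
    and "\<And>i. i \<in> {1..n} \<Longrightarrow> distr M borel (X i) = \<mu>"
    and "AE x in \<mu>. x \<in> {- a<..<a}"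
    and "distr M (\<Pi>\<^sub>M i\<in>{1..n}. borel) (\<lambda>\<omega>. \<lambda>i\<in>{1..n}. R i \<omega>) = dirichlet_ones n"
    and "prob_space.indep_var M
           (\<Pi>\<^sub>M i\<in>{1..n}. borel) (\<lambda>\<omega>. \<lambda>i\<in>{1..n}. R i \<omega>)
           (\<Pi>\<^sub>M i\<in>{1..n}. borel) (\<lambda>\<omega>. \<lambda>i\<in>{1..n}. X i \<omega>)"
  shows "distr M borel (\<lambda>\<omega>. \<Sum>i\<in>{1..n}. R i \<omega> * X i \<omega>)
           = beta_distr (real n * \<alpha>) (real n * (1 - \<alpha>)) (- a) (2 * a)
         \<longleftrightarrow> (\<forall>i\<in>{1..n}. distr M borel (X i) = arcsin_distr \<alpha> a)"
proof -
  \<comment> \<open>The inverse of \<open>\<lambda>x. - a + 2 * a * x\<close>, clamped to the unit interval.\<close>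
  define g :: "real \<Rightarrow> real" where "g = (\<lambda>x. max 0 (min 1 ((x + a) / (2 * a))))"
  interpret M: prob_space M by fact
  interpret dirichlet_average M X R \<mu> n g
    using assms by unfold_locales (auto simp: g_def)
  let ?aff = "\<lambda>x. - a + 2 * a * x"
  have g_inverse: "?aff (g x) = x" if "x \<in> {- a<..<a}" for x
    using that \<open>a > 0\<close> by (auto simp: g_def field_simps max_def min_def)
  have [measurable]: "g \<in> borel_measurable \<mu>"
    using g_measurable by (simp cong: measurable_cong_sets add: sets_law)
  have \<mu>_eq: "distr (distr \<mu> borel g) borel ?aff = \<mu>"
  proof -
    have "AE x in \<mu>. ?aff (g x) = x"
      using assms(8) by (rule eventually_mono) (rule g_inverse)
    then have "distr \<mu> borel (\<lambda>x. ?aff (g x)) = distr \<mu> borel (\<lambda>x. x)"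
      by (intro distr_cong_AE) (auto simp: sets_law cong: measurable_cong_sets)
    also have "\<dots> = \<mu>" by (intro distr_id2) (simp add: sets_law)
    finally show ?thesis by (simp add: distr_distr comp_def)
  qed
  have AE_X: "AE \<omega> in M. \<forall>i\<in>{1..n}. X i \<omega> \<in> {- a<..<a}"
  proof (intro AE_finite_allI)
    fix i assume i: "i \<in> {1..n}"
    have "AE x in distr M borel (X i). x \<in> {- a<..<a}"
      unfolding assms(7)[OF i] by (rule assms(8))
    then show "AE \<omega> in M. X i \<omega> \<in> {- a<..<a}"
      using measurable_X[OF i] by (subst (asm) AE_distr_iff) auto
  qed simp
  \<comment> \<open>The weights sum to one, so averaging commutes with affine maps.\<close>
  have S_eq: "distr M borel (\<lambda>\<omega>. \<Sum>i\<in>{1..n}. R i \<omega> * X i \<omega>) = distr (distr M borel average) borel ?aff"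
  proof -
    have "AE \<omega> in M. (\<Sum>i\<in>{1..n}. R i \<omega> * X i \<omega>) = ?aff (average \<omega>)"
      using AE_X AE_weights
    proof eventually_elim
      case (elim \<omega>)
      then have sum: "(\<Sum>i\<in>{1..n}. R i \<omega>) = 1" by (simp add: prob_simplex_def)
      have "(\<Sum>i\<in>{1..n}. R i \<omega> * X i \<omega>) = (\<Sum>i\<in>{1..n}. R i \<omega> * ?aff (g (X i \<omega>)))"
        using elim(1) by (intro sum.cong refl) (simp only: g_inverse)
      also have "\<dots> = - a * (\<Sum>i\<in>{1..n}. R i \<omega>) + 2 * a * average \<omega>"
        unfolding average_def sum_distrib_left sum.distrib[symmetric]
        by (intro sum.cong refl) (simp add: algebra_simps)
      finally show ?case using sum by simp
    qed
    moreover have "(\<lambda>\<omega>. \<Sum>i\<in>{1..n}. R i \<omega> * X i \<omega>) \<in> borel_measurable M"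
      using measurable_X measurable_R by (intro borel_measurable_sum borel_measurable_times)
    ultimately have "distr M borel (\<lambda>\<omega>. \<Sum>i\<in>{1..n}. R i \<omega> * X i \<omega>) =
        distr M borel (\<lambda>\<omega>. ?aff (average \<omega>))"
      by (intro distr_cong_AE) auto
    then show ?thesis by (simp add: distr_distr comp_def)
  qed
  have cancel: "distr A borel ?aff = beta_distr p q (- a) (2 * a) \<longleftrightarrow> A = std_beta p q"
    if "sets A = sets borel" for A p q
    using distr_affine_cancel[OF that, of "std_beta p q" "2 * a" "- a"] \<open>a > 0\<close>
    by (auto simp: beta_distr_def std_beta_def)
  have "distr M borel (\<lambda>\<omega>. \<Sum>i\<in>{1..n}. R i \<omega> * X i \<omega>)
           = beta_distr (real n * \<alpha>) (real n * (1 - \<alpha>)) (- a) (2 * a) \<longleftrightarrow>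
        distr M borel average = std_beta (real n * \<alpha>) (real n * (1 - \<alpha>))"
    unfolding S_eq by (rule cancel) simp
  also have "\<dots> \<longleftrightarrow> distr \<mu> borel g = std_beta \<alpha> (1 - \<alpha>)"
    by (rule average_std_beta_iff[OF assms(4,5)])
  also have "\<dots> \<longleftrightarrow> \<mu> = arcsin_distr \<alpha> a"
    using cancel[of "distr \<mu> borel g" \<alpha> "1 - \<alpha>"] unfolding \<mu>_eq arcsin_distr_def by auto
  also have "\<dots> \<longleftrightarrow> (\<forall>i\<in>{1..n}. distr M borel (X i) = arcsin_distr \<alpha> a)"
    using assms(2,7) by auto
  finally show ?thesis .
qed

end
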